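(* Let $Q$ be a probability distribution on $\mathcal{U}_d$, let $C_Q$ be the set of Fréchet means of $Q$ with respect to the Procrustean distance $d_P$, and let $C_{Q_n}$ be the set of empirical Fréchet means with respect to an i.i.d. sample of unlabeled networks $X_1,\dots,X_n\sim Q$. Assume that the Fréchet function of $Q$ is everywhere finite. Then the following hold. (a) The Fréchet mean set $C_Q$ is nonempty and compact. (b) For any $\epsilon>0$ there exist a positive-integer-valued random variable $N\equiv N(\epsilon)$ and a null set $\Omega(\epsilon)$ such that, outside of $\Omega(\epsilon)$, $$C_{Q_n}\subseteq C_Q^{\epsilon}:=\{p\in\mathcal{U}_d: d_P(p,C_Q)<\epsilon\}\qquad\text{for all } n\ge N.$$ (c) If $C_Q$ is a singleton, i.e. the Fréchet mean $\mu$ is unique, then the empirical Fréchet mean $\mu_n$ converges to $\mu$ almost surely.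
   Context: Let $d\ge2$, $D=\binom d2$, and $\mathcal{O}_D=\{\vec x\in\mathbb{R}^D: x^i\ge0\}$, whose coordinates are indexed by the edges $\{i,j\}$, $1\le i<j\le d$ (a vector in $\mathcal{O}_D$ is the vector of edge weights of a labeled undirected network on $d$ vertices). The group $\Sigma_d$ of permutations of $\{1,\dots,d\}$ acts on $\mathcal{O}_D$ by the induced permutation of edges: $(\sigma\cdot \vec x)_{\{i,j\}}=\vec x_{\{\sigma^{-1}(i),\sigma^{-1}(j)\}}$. The space of unlabeled networks is $\mathcal{U}_d=\mathcal{O}_D/\Sigma_d$, with elements $[\vec x]$. With $d_E$ the Euclidean distance, the Procrustean distance is $$d_P([\vec x],[\vec y])=\min_{\sigma_1,\sigma_2\in\Sigma_d}d_E(\sigma_1\cdot\vec x,\sigma_2\cdot\vec y).$$ Distributions on $\mathcal{U}_d$ are Borel probability measures. The Fréchet function of $Q$ is $f(p)=\int_{\mathcal{U}_d}d_P^2(p,z)\,Q(dz)$, $p\in\mathcal{U}_d$; the Fréchet mean set $C_Q$ is the set of its minimizers. For a sample $X_1,\dots,X_n$, the empirical distribution is $Q_n=\frac1n\sum_{i=1}^n\delta_{X_i}$, $C_{Q_n}$ is the set of minimizers of $p\mapsto\frac1n\sum_{i=1}^n d_P^2(p,X_i)$, and an empirical Fréchet mean $\mu_n$ is a (measurably chosen) element of $C_{Q_n}$. The variables $X_1,X_2,\dots$ are i.i.d. with law $Q$ on a common probability space; "null set" means a set of probability zero in this probability space. *)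

theory Defs
  imports "HOL-Probability.Probability"
begin

definition edges :: "nat \<Rightarrow> nat set set" where
  "edges d = {e. e \<subseteq> {1..d} \<and> card e = 2}"

definition labeled_networks :: "nat \<Rightarrow> (nat set \<Rightarrow> real) set" where
  "labeled_networks d = edges d \<rightarrow>\<^sub>E {0..}"

definition perm_act :: "nat \<Rightarrow> (nat \<Rightarrow> nat) \<Rightarrow> (nat set \<Rightarrow> real) \<Rightarrow> (nat set \<Rightarrow> real)" where
  "perm_act d \<sigma> x = (\<lambda>e\<in>edges d. x (inv \<sigma> ` e))"

definition net_class :: "nat \<Rightarrow> (nat set \<Rightarrow> real) \<Rightarrow> (nat set \<Rightarrow> real) set" where
  "net_class d x = {perm_act d \<sigma> x | \<sigma>. \<sigma> permutes {1..d}}"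

definition unlabeled_networks :: "nat \<Rightarrow> (nat set \<Rightarrow> real) set set" where
  "unlabeled_networks d = net_class d ` labeled_networks d"

definition edge_dist :: "nat \<Rightarrow> (nat set \<Rightarrow> real) \<Rightarrow> (nat set \<Rightarrow> real) \<Rightarrow> real" where
  "edge_dist d x y = sqrt (\<Sum>e\<in>edges d. (x e - y e)\<^sup>2)"

(* For p = [x] and q = [y] the vectors u, v range exactly over the relabelings
   of x and of y; see procrustes_dist_net_class.  The value 0 off the quotient is
   irrelevant; it is there because the locale Metric_space wants d x y >= 0 and
   symmetry for all x, y of the type. *)
definition procrustes_dist ::
    "nat \<Rightarrow> (nat set \<Rightarrow> real) set \<Rightarrow> (nat set \<Rightarrow> real) set \<Rightarrow> real" where
  "procrustes_dist d p q =
     (if p \<in> unlabeled_networks d \<and> q \<in> unlabeled_networks d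
      then Min {edge_dist d u v | u v. u \<in> p \<and> v \<in> q} else 0)"

lemma procrustes_dist_net_class:
  assumes "x \<in> labeled_networks d" "y \<in> labeled_networks d"
  shows "procrustes_dist d (net_class d x) (net_class d y) =
     Min {edge_dist d (perm_act d \<sigma> x) (perm_act d \<tau> y) | \<sigma> \<tau>.
            \<sigma> permutes {1..d} \<and> \<tau> permutes {1..d}}"
proof -
  have "{edge_dist d u v | u v. u \<in> net_class d x \<and> v \<in> net_class d y} =
        {edge_dist d (perm_act d \<sigma> x) (perm_act d \<tau> y) | \<sigma> \<tau>.
            \<sigma> permutes {1..d} \<and> \<tau> permutes {1..d}}"
    unfolding net_class_def by blast
  moreover have "net_class d x \<in> unlabeled_networks d" "net_class d y \<in> unlabeled_networks d"
    using assms by (simp_all add: unlabeled_networks_def)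
  ultimately show ?thesis by (simp add: procrustes_dist_def)
qed

lemma permutes_image_edges:
  assumes "\<sigma> permutes {1..d}" "e \<in> edges d"
  shows "\<sigma> ` e \<in> edges d"
proof -
  have "card (\<sigma> ` e) = card e"
    using permutes_inj_on[OF assms(1)] by (rule card_image)
  moreover have "\<sigma> ` e \<subseteq> {1..d}"
    using assms permutes_image[OF assms(1)] unfolding edges_def by blast
  ultimately show ?thesis using assms(2) by (simp add: edges_def)
qed

lemma bij_betw_image_edges:
  assumes "\<sigma> permutes {1..d}"
  shows "bij_betw (\<lambda>e. \<sigma> ` e) (edges d) (edges d)"
proof (rule bij_betw_byWitness[where f' = "\<lambda>e. inv \<sigma> ` e"])
  show "\<forall>e\<in>edges d. inv \<sigma> ` \<sigma> ` e = e" "\<forall>e\<in>edges d. \<sigma> ` inv \<sigma> ` e = e"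
    using permutes_inverses[OF assms] by (auto simp: image_image)
  show "(\<lambda>e. \<sigma> ` e) ` edges d \<subseteq> edges d" "(\<lambda>e. inv \<sigma> ` e) ` edges d \<subseteq> edges d"
    using assms permutes_inv[OF assms] by (auto intro: permutes_image_edges)
qed

lemma perm_act_compose:
  assumes "\<sigma> permutes {1..d}" "\<tau> permutes {1..d}"
  shows "perm_act d \<sigma> (perm_act d \<tau> x) = perm_act d (\<sigma> \<circ> \<tau>) x"
proof
  fix e
  have "inv (\<sigma> \<circ> \<tau>) = inv \<tau> \<circ> inv \<sigma>"
    using assms by (simp add: o_inv_distrib permutes_bij)
  then show "perm_act d \<sigma> (perm_act d \<tau> x) e = perm_act d (\<sigma> \<circ> \<tau>) x e"
    using permutes_image_edges[OF permutes_inv[OF assms(1)]]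
    by (auto simp: perm_act_def image_comp)
qed

lemma perm_act_id:
  assumes "x \<in> labeled_networks d"
  shows "perm_act d id x = x"
  using assms by (auto simp: perm_act_def labeled_networks_def PiE_def extensional_def)

lemma perm_act_labeled:
  assumes "\<sigma> permutes {1..d}" "x \<in> labeled_networks d"
  shows "perm_act d \<sigma> x \<in> labeled_networks d"
  using assms permutes_image_edges[OF permutes_inv[OF assms(1)]]
  by (fastforce simp: perm_act_def labeled_networks_def)

lemma edge_dist_perm_act:
  assumes "\<sigma> permutes {1..d}"
  shows "edge_dist d (perm_act d \<sigma> x) (perm_act d \<sigma> y) = edge_dist d x y"
  using sum.reindex_bij_betw[OF bij_betw_image_edges[OF permutes_inv[OF assms]],
      of "\<lambda>e. (x e - y e)\<^sup>2"]
  by (simp add: edge_dist_def perm_act_def)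

lemma edge_dist_triangle: "edge_dist d x z \<le> edge_dist d x y + edge_dist d y z"
  using L2_set_triangle_ineq[of "\<lambda>e. x e - y e" "\<lambda>e. y e - z e" "edges d"]
  by (simp add: edge_dist_def L2_set_def)

lemma edge_dist_commute: "edge_dist d x y = edge_dist d y x"
  by (simp add: edge_dist_def power2_commute)

lemma finite_edges: "finite (edges d)"
  by (rule finite_subset[of _ "Pow {1..d}"]) (auto simp: edges_def)

lemma edge_dist_eq_0:
  assumes "x \<in> labeled_networks d" "y \<in> labeled_networks d"
  shows "edge_dist d x y = 0 \<longleftrightarrow> x = y"
proof
  assume "edge_dist d x y = 0"
  then have "\<forall>e\<in>edges d. x e = y e"
    by (simp add: edge_dist_def sum_nonneg_eq_0_iff[OF finite_edges])
  then show "x = y"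
    using assms by (auto simp: labeled_networks_def intro: PiE_ext)
qed (simp add: edge_dist_def)

lemma finite_net_class: "finite (net_class d x)"
  using finite_permutations[of "{1..d}"] by (simp add: net_class_def)

lemma net_class_self: "x \<in> labeled_networks d \<Longrightarrow> x \<in> net_class d x"
  unfolding net_class_def mem_Collect_eq
  by (rule exI[of _ id]) (simp add: perm_act_id permutes_id)

lemma net_class_trans:
  assumes "u \<in> net_class d x" "v \<in> net_class d x" "x \<in> labeled_networks d"
  shows "\<exists>\<rho>. \<rho> permutes {1..d} \<and> v = perm_act d \<rho> u"
proof -
  obtain \<sigma> \<tau> where st: "\<sigma> permutes {1..d}" "\<tau> permutes {1..d}"
      "u = perm_act d \<sigma> x" "v = perm_act d \<tau> x"
    using assms by (auto simp: net_class_def)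
  have "\<tau> \<circ> inv \<sigma> permutes {1..d}"
    using st by (simp add: permutes_compose permutes_inv)
  moreover have "perm_act d (\<tau> \<circ> inv \<sigma>) u = v"
    using st calculation permutes_inv_o(2)[OF st(1)]
    by (simp add: perm_act_compose o_assoc[symmetric])
  ultimately show ?thesis by blast
qed

lemma net_class_perm_act:
  assumes "u \<in> net_class d x" "\<rho> permutes {1..d}"
  shows "perm_act d \<rho> u \<in> net_class d x"
proof -
  obtain \<sigma> where "\<sigma> permutes {1..d}" "u = perm_act d \<sigma> x"
    using assms(1) by (auto simp: net_class_def)
  then have "\<rho> \<circ> \<sigma> permutes {1..d}" "perm_act d \<rho> u = perm_act d (\<rho> \<circ> \<sigma>) x"
    using assms(2) by (simp_all add: perm_act_compose permutes_compose)
  then show ?thesis unfolding net_class_def by blast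
qed

lemma finite_dists:
  assumes "p \<in> unlabeled_networks d" "q \<in> unlabeled_networks d"
  shows "finite {edge_dist d u v | u v. u \<in> p \<and> v \<in> q}"
  using assms finite_net_class by (auto simp: unlabeled_networks_def intro!: finite_image_set2)

lemma procrustes_dist_attained:
  assumes "p \<in> unlabeled_networks d" "q \<in> unlabeled_networks d"
  obtains u v where "u \<in> p" "v \<in> q" "procrustes_dist d p q = edge_dist d u v"
proof -
  have "{edge_dist d u v | u v. u \<in> p \<and> v \<in> q} \<noteq> {}"
    using assms net_class_self unfolding unlabeled_networks_def by blast
  from Min_in[OF finite_dists[OF assms] this] show ?thesis
    using that assms by (auto simp: procrustes_dist_def)
qed

lemma procrustes_dist_le:
  assumes "p \<in> unlabeled_networks d" "q \<in> unlabeled_networks d" "u \<in> p" "v \<in> q"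
  shows "procrustes_dist d p q \<le> edge_dist d u v"
  using finite_dists[OF assms(1,2)] assms by (auto simp: procrustes_dist_def intro: Min_le)

lemma unlabeled_networks_memb:
  assumes "p \<in> unlabeled_networks d" "u \<in> p"
  shows "u \<in> labeled_networks d" "p = net_class d u"
proof -
  obtain x where x: "x \<in> labeled_networks d" "p = net_class d x"
    using assms by (auto simp: unlabeled_networks_def)
  show u: "u \<in> labeled_networks d"
    using assms x perm_act_labeled by (auto simp: net_class_def)
  show "p = net_class d u"
  proof
    show "p \<subseteq> net_class d u"
      using net_class_trans[of u d x] assms(2) x unfolding net_class_def[of d u] by blast
    show "net_class d u \<subseteq> p"
      using net_class_perm_act assms(2) x unfolding net_class_def[of d u] by auto
  qed
qed

lemma Metric_space_procrustes:
  "Metric_space (unlabeled_networks d) (procrustes_dist d)"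
proof
  show "0 \<le> procrustes_dist d p q" for p q
  proof (cases "p \<in> unlabeled_networks d \<and> q \<in> unlabeled_networks d")
    case True
    then obtain u v where "procrustes_dist d p q = edge_dist d u v"
      using procrustes_dist_attained[of p d q] by blast
    then show ?thesis by (simp add: edge_dist_def sum_nonneg)
  next
    case False
    then show ?thesis by (auto simp: procrustes_dist_def)
  qed
next
  fix p q
  have "{edge_dist d u v | u v. u \<in> p \<and> v \<in> q} = {edge_dist d u v | u v. u \<in> q \<and> v \<in> p}"
    using edge_dist_commute by blast
  then show "procrustes_dist d p q = procrustes_dist d q p"
    by (simp add: procrustes_dist_def conj_commute)
next
  fix p q assume pq: "p \<in> unlabeled_networks d" "q \<in> unlabeled_networks d"
  obtain u v where uv: "u \<in> p" "v \<in> q" "procrustes_dist d p q = edge_dist d u v"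
    using procrustes_dist_attained[OF pq] .
  show "procrustes_dist d p q = 0 \<longleftrightarrow> p = q"
  proof
    assume "procrustes_dist d p q = 0"
    then have "u = v"
      using uv edge_dist_eq_0 unlabeled_networks_memb(1)[OF pq(1) uv(1)]
        unlabeled_networks_memb(1)[OF pq(2) uv(2)] by simp
    then show "p = q"
      using unlabeled_networks_memb(2)[OF pq(1) uv(1)]
        unlabeled_networks_memb(2)[OF pq(2) uv(2)] by simp
  next
    assume "p = q"
    then have "procrustes_dist d p q \<le> 0"
      using procrustes_dist_le[OF pq uv(1), of u] uv(1) by (simp add: edge_dist_def)
    moreover have "0 \<le> edge_dist d u v" by (simp add: edge_dist_def sum_nonneg)
    ultimately show "procrustes_dist d p q = 0" using uv(3) by simp
  qed
next
  fix p q r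
  assume pqr: "p \<in> unlabeled_networks d" "q \<in> unlabeled_networks d" "r \<in> unlabeled_networks d"
  obtain u v where uv: "u \<in> p" "v \<in> q" "procrustes_dist d p q = edge_dist d u v"
    using procrustes_dist_attained[OF pqr(1,2)] .
  obtain v' w where vw: "v' \<in> q" "w \<in> r" "procrustes_dist d q r = edge_dist d v' w"
    using procrustes_dist_attained[OF pqr(2,3)] .
  obtain \<rho> where \<rho>: "\<rho> permutes {1..d}" "v = perm_act d \<rho> v'"
    using unlabeled_networks_memb(2)[OF pqr(2) vw(1)] uv(2) by (auto simp: net_class_def)
  have "perm_act d \<rho> w \<in> r"
    using unlabeled_networks_memb(2)[OF pqr(3) vw(2)] \<rho>(1) by (auto simp: net_class_def)
  then have "procrustes_dist d p r \<le> edge_dist d u (perm_act d \<rho> w)"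
    using procrustes_dist_le pqr uv by blast
  also have "\<dots> \<le> edge_dist d u v + edge_dist d v (perm_act d \<rho> w)"
    by (rule edge_dist_triangle)
  also have "edge_dist d v (perm_act d \<rho> w) = edge_dist d v' w"
    using \<rho> edge_dist_perm_act by simp
  finally show "procrustes_dist d p r \<le> procrustes_dist d p q + procrustes_dist d q r"
    using uv(3) vw(3) by simp
qed

definition network_topology :: "nat \<Rightarrow> (nat set \<Rightarrow> real) set topology" where
  "network_topology d = Metric_space.mtopology (unlabeled_networks d) (procrustes_dist d)"

definition network_borel :: "nat \<Rightarrow> (nat set \<Rightarrow> real) set measure" where
  "network_borel d = sigma (unlabeled_networks d) {U. openin (network_topology d) U}"

(* Values in [0, \<infinity>], so that finiteness is a hypothesis and not built into the integral. *)
definition frechet_fun ::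
    "nat \<Rightarrow> (nat set \<Rightarrow> real) set measure \<Rightarrow> (nat set \<Rightarrow> real) set \<Rightarrow> ennreal" where
  "frechet_fun d Q p = (\<integral>\<^sup>+ z. ennreal ((procrustes_dist d p z)\<^sup>2) \<partial>Q)"

definition frechet_mean_set ::
    "nat \<Rightarrow> (nat set \<Rightarrow> real) set measure \<Rightarrow> (nat set \<Rightarrow> real) set set" where
  "frechet_mean_set d Q =
     {p \<in> unlabeled_networks d. \<forall>q\<in>unlabeled_networks d. frechet_fun d Q p \<le> frechet_fun d Q q}"

definition empirical_frechet_fun ::
    "nat \<Rightarrow> nat \<Rightarrow> (nat \<Rightarrow> (nat set \<Rightarrow> real) set) \<Rightarrow> (nat set \<Rightarrow> real) set \<Rightarrow> real" where
  "empirical_frechet_fun d n x p = (1 / real n) * (\<Sum>i=1..n. (procrustes_dist d p (x i))\<^sup>2)"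

definition empirical_frechet_mean_set ::
    "nat \<Rightarrow> nat \<Rightarrow> (nat \<Rightarrow> (nat set \<Rightarrow> real) set) \<Rightarrow> (nat set \<Rightarrow> real) set set" where
  "empirical_frechet_mean_set d n x =
     {p \<in> unlabeled_networks d. \<forall>q\<in>unlabeled_networks d.
        empirical_frechet_fun d n x p \<le> empirical_frechet_fun d n x q}"

definition procrustes_setdist ::
    "nat \<Rightarrow> (nat set \<Rightarrow> real) set \<Rightarrow> (nat set \<Rightarrow> real) set set \<Rightarrow> real" where
  "procrustes_setdist d p C = (INF q\<in>C. procrustes_dist d p q)"

definition procrustes_nbhd ::
    "nat \<Rightarrow> real \<Rightarrow> (nat set \<Rightarrow> real) set set \<Rightarrow> (nat set \<Rightarrow> real) set set" where
  "procrustes_nbhd d \<epsilon> C = {p \<in> unlabeled_networks d. procrustes_setdist d p C < \<epsilon>}"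

end

theory Submission
  imports Defs "HOL-Library.Discrete_Functions" "HOL-Real_Asymp.Real_Asymp"
begin

text \<open>
  Fix a Frechet mean \<open>\<mu>\<close> and work with the excess \<open>\<rho>(p, z)\<^sup>2 - \<rho>(\<mu>, z)\<^sup>2\<close>, which differs from the
  squared distance by a term independent of \<open>p\<close>. It is bounded by a linear function of \<open>\<rho>(\<mu>, z)\<close>,
  hence square integrable under \<open>Q\<close>, so a strong law for square-integrable variables is enough although
  \<open>\<rho>(p, z)\<^sup>2\<close> itself is only integrable. Closed balls of the quotient are compact, being covered by
  images of boxes of labeled networks. By coercivity, minimizers of both the population and the
  empirical functional lie within twice the mean distance to \<open>\<mu>\<close>. This gives (a), and it reduces (b) to
  the compact set of points of a fixed ball that are \<open>\<epsilon>\<close>-far from the mean set. There the expected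
  excess is positive; a finite cover on whose pieces the empirical excess varies little reduces its
  positivity for large \<open>n\<close> to the strong law at finitely many points.
\<close>

subsection \<open>A strong law of large numbers\<close>

text \<open>For nonnegative terms the partial sums are monotone, so the averages between consecutive squares
  are squeezed between those at the squares.\<close>
lemma averages_tendsto_of_squares:
  fixes a :: "nat \<Rightarrow> real"
  assumes nonneg: "\<And>i. i \<ge> 1 \<Longrightarrow> 0 \<le> a i"
    and lim: "(\<lambda>k. (\<Sum>i=1..k\<^sup>2. a i) / real (k\<^sup>2)) \<longlonglongrightarrow> m"
  shows "(\<lambda>n. (\<Sum>i=1..n. a i) / real n) \<longlonglongrightarrow> m"
proof -
  define S where "S n = (\<Sum>i=1..n. a i)" for n
  have S_mono: "S n \<le> S n'" if "n \<le> n'" for n n'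
    unfolding S_def using that nonneg by (intro sum_mono2) auto
  have S_nonneg: "0 \<le> S n" for n
    unfolding S_def using nonneg by (intro sum_nonneg) auto
  have lim': "(\<lambda>k. S (k\<^sup>2) / real (k\<^sup>2)) \<longlonglongrightarrow> m"
    using lim by (simp add: S_def)
  have sqrt_top: "filterlim floor_sqrt at_top sequentially"
  proof (rule filterlim_at_top[THEN iffD2], intro allI)
    fix Z show "\<forall>\<^sub>F n in sequentially. Z \<le> floor_sqrt n"
      using eventually_ge_at_top[of "Z\<^sup>2"] by eventually_elim (simp add: le_floor_sqrt_iff)
  qed
  \<comment> \<open>For k^2 <= n < (k+1)^2 the lower bound of \<open>S n / real n\<close> takes its
    numerator at k^2 and its denominator at (k+1)^2. The extra factor tends to 1 and only exchanges
    the normalization; \<open>up\<close> does the same for the upper bound.\<close>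
  have "(\<lambda>k. S (k\<^sup>2) / real (k\<^sup>2) * (real k / (real k + 1))\<^sup>2) \<longlonglongrightarrow> m * 1"
    by (intro tendsto_mult lim') real_asymp
  moreover have "\<forall>\<^sub>F k in sequentially.
      S (k\<^sup>2) / real (k\<^sup>2) * (real k / (real k + 1))\<^sup>2 = S (k\<^sup>2) / real ((Suc k)\<^sup>2)"
    using eventually_gt_at_top[of 0] by eventually_elim (simp add: power_divide add.commute)
  ultimately have low: "(\<lambda>k. S (k\<^sup>2) / real ((Suc k)\<^sup>2)) \<longlonglongrightarrow> m"
    using Lim_transform_eventually by fastforce
  have "(\<lambda>k. S ((Suc k)\<^sup>2) / real ((Suc k)\<^sup>2) * ((real k + 1) / real k)\<^sup>2) \<longlonglongrightarrow> m * 1"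
    by (intro tendsto_mult LIMSEQ_Suc[OF lim']) real_asymp
  then have up: "(\<lambda>k. S ((Suc k)\<^sup>2) / real (k\<^sup>2)) \<longlonglongrightarrow> m"
    by (simp add: power_divide add.commute del: of_nat_Suc) (simp add: add.commute)
  have "(\<lambda>n. S n / real n) \<longlonglongrightarrow> m"
  proof (rule tendsto_sandwich)
    show "(\<lambda>n. S ((floor_sqrt n)\<^sup>2) / real ((Suc (floor_sqrt n))\<^sup>2)) \<longlonglongrightarrow> m"
      by (rule filterlim_compose[OF low sqrt_top])
    show "(\<lambda>n. S ((Suc (floor_sqrt n))\<^sup>2) / real ((floor_sqrt n)\<^sup>2)) \<longlonglongrightarrow> m"
      by (rule filterlim_compose[OF up sqrt_top])
    show "\<forall>\<^sub>F n in sequentially. S ((floor_sqrt n)\<^sup>2) / real ((Suc (floor_sqrt n))\<^sup>2) \<le> S n / real n"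
      using eventually_gt_at_top[of 0]
    proof eventually_elim
      case (elim n)
      then show ?case
        using Suc_floor_sqrt_power2_gt[of n]
        by (intro frac_le S_mono S_nonneg) (simp_all add: floor_sqrt_power2_le del: of_nat_power of_nat_Suc)
    qed
    show "\<forall>\<^sub>F n in sequentially. S n / real n \<le> S ((Suc (floor_sqrt n))\<^sup>2) / real ((floor_sqrt n)\<^sup>2)"
      using eventually_gt_at_top[of 0]
    proof eventually_elim
      case (elim n)
      then show ?case
        using Suc_floor_sqrt_power2_gt[of n] 
        by (intro frac_le S_mono S_nonneg)
          (simp_all add: floor_sqrt_power2_le less_imp_le del: of_nat_power of_nat_Suc)
    qed
  qed
  then show ?thesis by (simp add: S_def)
qed

section \<open>Second-moment arguments for independent variables\<close>

context prob_space
begin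

text \<open>Pythagoras in L2: in the expanded square only the diagonal terms survive.\<close>

lemma expectation_square_sum_orthogonal:
  fixes Z :: "'i \<Rightarrow> 'a \<Rightarrow> real"
  assumes "finite I"
    and int: "\<And>i j. i \<in> I \<Longrightarrow> j \<in> I \<Longrightarrow> integrable M (\<lambda>x. Z i x * Z j x)"
    and orth: "\<And>i j. i \<in> I \<Longrightarrow> j \<in> I \<Longrightarrow> i \<noteq> j \<Longrightarrow> expectation (\<lambda>x. Z i x * Z j x) = 0"
  shows "integrable M (\<lambda>x. (\<Sum>i\<in>I. Z i x)\<^sup>2)"
    and "expectation (\<lambda>x. (\<Sum>i\<in>I. Z i x)\<^sup>2) = (\<Sum>i\<in>I. expectation (\<lambda>x. (Z i x)\<^sup>2))"
proof -
  have eq: "(\<lambda>x. (\<Sum>i\<in>I. Z i x)\<^sup>2) = (\<lambda>x. \<Sum>i\<in>I. \<Sum>j\<in>I. Z i x * Z j x)"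
    by (simp add: power2_eq_square sum_product)
  show "integrable M (\<lambda>x. (\<Sum>i\<in>I. Z i x)\<^sup>2)"
    unfolding eq by (intro Bochner_Integration.integrable_sum int)
  have "expectation (\<lambda>x. (\<Sum>i\<in>I. Z i x)\<^sup>2) = (\<Sum>i\<in>I. \<Sum>j\<in>I. expectation (\<lambda>x. Z i x * Z j x))"
    unfolding eq using int by (simp add: Bochner_Integration.integral_sum)
  also have "\<dots> = (\<Sum>i\<in>I. \<Sum>j\<in>I. if j = i then expectation (\<lambda>x. (Z i x)\<^sup>2) else 0)"
    using orth by (intro sum.cong refl) (auto simp: power2_eq_square)
  also have "\<dots> = (\<Sum>i\<in>I. expectation (\<lambda>x. (Z i x)\<^sup>2))"
    using \<open>finite I\<close> by (simp add: sum.delta)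
  finally show "expectation (\<lambda>x. (\<Sum>i\<in>I. Z i x)\<^sup>2) = (\<Sum>i\<in>I. expectation (\<lambda>x. (Z i x)\<^sup>2))" .
qed

text \<open>By monotone convergence the random series of squares has finite expectation, so it
  converges almost surely and its terms vanish in the limit. This takes the place of Chebyshev plus
  Borel-Cantelli.\<close>

lemma AE_tendsto_0_of_summable_second_moments:
  fixes T :: "nat \<Rightarrow> 'a \<Rightarrow> real"
  assumes int: "\<And>k. integrable M (\<lambda>x. (T k x)\<^sup>2)"
    and sum: "summable (\<lambda>k. expectation (\<lambda>x. (T k x)\<^sup>2))"
  shows "AE x in M. (\<lambda>k. T k x) \<longlonglongrightarrow> 0"
proof -
  have [measurable]: "(\<lambda>x. (T k x)\<^sup>2) \<in> borel_measurable M" for k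
    using int by (rule borel_measurable_integrable)
  have "(\<integral>\<^sup>+x. (\<Sum>k. ennreal ((T k x)\<^sup>2)) \<partial>M) = (\<Sum>k. \<integral>\<^sup>+x. ennreal ((T k x)\<^sup>2) \<partial>M)"
    by (rule nn_integral_suminf) simp
  also have "\<dots> = (\<Sum>k. ennreal (expectation (\<lambda>x. (T k x)\<^sup>2)))"
    using int by (simp add: nn_integral_eq_integral)
  also have "\<dots> \<noteq> \<infinity>"
    using sum by (simp add: suminf_ennreal2)
  finally have "AE x in M. (\<Sum>k. ennreal ((T k x)\<^sup>2)) \<noteq> \<infinity>"
    by (intro nn_integral_PInf_AE) simp_all
  then show ?thesis
  proof eventually_elim
    case (elim x)
    then have "summable (\<lambda>k. (T k x)\<^sup>2)"
      by (intro summable_suminf_not_top) auto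
    then have "(\<lambda>k. sqrt ((T k x)\<^sup>2)) \<longlonglongrightarrow> sqrt 0"
      by (intro tendsto_real_sqrt summable_LIMSEQ_zero)
    then show ?case by (simp add: tendsto_rabs_zero_iff)
  qed
qed

text \<open>The centred average of k^2 terms has second moment at most v / k^2, which is summable,
  so convergence holds along the squares. Nonnegativity fills the gaps by
  \<open>averages_tendsto_of_squares\<close>.\<close>

lemma strong_law_nonneg:
  fixes Y :: "nat \<Rightarrow> 'a \<Rightarrow> real"
  assumes indep: "indep_vars (\<lambda>_. borel) Y {1..}"
    and nonneg: "\<And>i x. i \<ge> 1 \<Longrightarrow> x \<in> space M \<Longrightarrow> 0 \<le> Y i x"
    and sq: "\<And>i. i \<ge> 1 \<Longrightarrow> integrable M (\<lambda>x. (Y i x)\<^sup>2)"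
    and mean: "\<And>i. i \<ge> 1 \<Longrightarrow> expectation (Y i) = m"
    and bound: "\<And>i. i \<ge> 1 \<Longrightarrow> expectation (\<lambda>x. (Y i x)\<^sup>2) \<le> v"
  shows "AE x in M. (\<lambda>n. (\<Sum>i=1..n. Y i x) / real n) \<longlonglongrightarrow> m"
proof -
  define Z where "Z i x = Y i x - m" for i x
  have Y_meas: "Y i \<in> borel_measurable M" if "i \<ge> 1" for i
    using indep that by (simp add: indep_vars_def)
  have Y_int: "integrable M (Y i)" if "i \<ge> 1" for i
    using Y_meas[OF that] sq[OF that] by (rule square_integrable_imp_integrable)
  have Z_int: "integrable M (Z i)" if "i \<ge> 1" for i
    unfolding Z_def using Y_int[OF that] by simp
  have Z_mean: "expectation (Z i) = 0" if "i \<ge> 1" for i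
    unfolding Z_def using Y_int[OF that] mean[OF that] by (simp add: prob_space)
  have Z_indep: "indep_vars (\<lambda>_. borel) Z {1..}"
    unfolding Z_def by (rule indep_vars_compose2[OF indep, where Y = "\<lambda>_ y. y - m"]) simp
  have Z_sq: "integrable M (\<lambda>x. (Z i x)\<^sup>2)" if "i \<ge> 1" for i
    unfolding Z_def power2_diff using Y_int[OF that] sq[OF that] by simp
  have Z_bound: "expectation (\<lambda>x. (Z i x)\<^sup>2) \<le> v" if "i \<ge> 1" for i
  proof -
    have "expectation (\<lambda>x. (Z i x)\<^sup>2) = expectation (\<lambda>x. (Y i x)\<^sup>2) - (expectation (Y i))\<^sup>2"
      using variance_eq[OF Y_int[OF that] sq[OF that]] mean[OF that] by (simp add: Z_def)
    also have "\<dots> \<le> expectation (\<lambda>x. (Y i x)\<^sup>2)" by simp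
    finally show ?thesis using bound[OF that] by simp
  qed
  have Z_prod: "integrable M (\<lambda>x. Z i x * Z j x)" "expectation (\<lambda>x. Z i x * Z j x) = 0"
    if "i \<ge> 1" "j \<ge> 1" "i \<noteq> j" for i j
  proof -
    have ind: "indep_vars (\<lambda>_. borel) Z {i, j}"
      by (rule indep_vars_subset[OF Z_indep]) (use that in auto)
    show "integrable M (\<lambda>x. Z i x * Z j x)"
      using indep_vars_integrable[OF _ ind] Z_int that by auto
    show "expectation (\<lambda>x. Z i x * Z j x) = 0"
      using indep_vars_lebesgue_integral[OF _ ind] Z_int Z_mean that by auto
  qed
  have Z_prod': "integrable M (\<lambda>x. Z i x * Z j x)" if "i \<ge> 1" "j \<ge> 1" for i j
    using Z_prod(1) Z_sq that by (cases "i = j") (auto simp: power2_eq_square)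
  define T where "T k x = (\<Sum>i=1..k\<^sup>2. Z i x) / real (k\<^sup>2)" for k x
  have T_sq: "(T k x)\<^sup>2 = (\<Sum>i=1..k\<^sup>2. Z i x)\<^sup>2 / (real (k\<^sup>2))\<^sup>2" for k x
    by (simp add: T_def power_divide)
  have T_int: "integrable M (\<lambda>x. (T k x)\<^sup>2)" for k
    unfolding T_sq
    by (intro integrable_divide expectation_square_sum_orthogonal) (auto intro: Z_prod Z_prod')
  \<comment> \<open>At \<open>k = 0\<close> both sides are 0, since division by zero yields
    0.\<close>
  have T_bound: "expectation (\<lambda>x. (T k x)\<^sup>2) \<le> v * (1 / real k ^ 2)" for k
  proof -
    have "expectation (\<lambda>x. (T k x)\<^sup>2) = (\<Sum>i=1..k\<^sup>2. expectation (\<lambda>x. (Z i x)\<^sup>2)) / (real (k\<^sup>2))\<^sup>2"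
      unfolding T_sq
      by (subst expectation_square_sum_orthogonal(2)[symmetric]) (auto intro: Z_prod Z_prod')
    also have "\<dots> \<le> (\<Sum>i=1..k\<^sup>2. v) / (real (k\<^sup>2))\<^sup>2"
      by (intro divide_right_mono sum_mono Z_bound) auto
    also have "\<dots> = v * (1 / real k ^ 2)"
      by (simp add: power2_eq_square)
    finally show ?thesis .
  qed
  have "summable (\<lambda>k. expectation (\<lambda>x. (T k x)\<^sup>2))"
  proof (rule summable_comparison_test')
    show "summable (\<lambda>k. v * (1 / real k ^ 2))"
      using inverse_power_summable[of 2, where 'a = real]
      by (intro summable_mult) (simp add: inverse_eq_divide)
    show "norm (expectation (\<lambda>x. (T k x)\<^sup>2)) \<le> v * (1 / real k ^ 2)" for k
      using T_bound[of k] by (simp add: integral_nonneg_AE)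
  qed
  from AE_tendsto_0_of_summable_second_moments[OF T_int this] AE_space show ?thesis
  proof eventually_elim
    case (elim x)
    have "(\<lambda>k. T k x + m) \<longlonglongrightarrow> 0 + m"
      using elim(1) by (intro tendsto_intros)
    moreover have "\<forall>\<^sub>F k in sequentially. T k x + m = (\<Sum>i=1..k\<^sup>2. Y i x) / real (k\<^sup>2)"
      using eventually_gt_at_top[of 0]
      by eventually_elim (simp add: T_def Z_def sum_subtractf field_simps)
    ultimately have "(\<lambda>k. (\<Sum>i=1..k\<^sup>2. Y i x) / real (k\<^sup>2)) \<longlonglongrightarrow> m"
      using Lim_transform_eventually by fastforce
    with nonneg elim(2) show ?case by (intro averages_tendsto_of_squares) auto
  qed
qed

end

text \<open>Positive and negative parts of \<open>g\<close> are dominated by \<open>g\<close> in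
  absolute value, hence square integrable, and \<open>strong_law_nonneg\<close> applies to each of
  them separately.\<close>

theorem (in prob_space) strong_law_square_integrable:
  fixes g :: "'b \<Rightarrow> real"
  assumes indep: "indep_vars (\<lambda>_. N) X {1..}"
    and law: "\<And>i. i \<ge> 1 \<Longrightarrow> distr M N (X i) = Q"
    and g[measurable]: "g \<in> borel_measurable N"
    and sq: "integrable Q (\<lambda>z. (g z)\<^sup>2)"
  shows "AE x in M. (\<lambda>n. (\<Sum>i=1..n. g (X i x)) / real n) \<longlonglongrightarrow> (\<integral>z. g z \<partial>Q)"
proof -
  have X[measurable]: "X i \<in> M \<rightarrow>\<^sub>M N" if "i \<ge> 1" for i
    using indep that by (simp add: indep_vars_def)
  have sets_Q[measurable_cong]: "sets Q = sets N"
    using law[of 1] by (metis order_refl sets_distr)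
  interpret Q: prob_space Q
    using prob_space_distr[OF X[of 1]] law[of 1] by simp
  have nonneg_case: "AE x in M. (\<lambda>n. (\<Sum>i=1..n. h (X i x)) / real n) \<longlonglongrightarrow> (\<integral>z. h z \<partial>Q)"
    if h[measurable]: "h \<in> borel_measurable N" and nonneg: "\<And>z. 0 \<le> h z"
      and h_sq: "integrable Q (\<lambda>z. (h z)\<^sup>2)" for h :: "'b \<Rightarrow> real"
  proof (rule strong_law_nonneg[where v = "\<integral>z. (h z)\<^sup>2 \<partial>Q"])
    show "indep_vars (\<lambda>_. borel) (\<lambda>i x. h (X i x)) {1..}"
      by (rule indep_vars_compose2[OF indep]) simp
  next
    fix i :: nat assume i: "i \<ge> 1"
    note [measurable] = X[OF i]
    show "integrable M (\<lambda>x. (h (X i x))\<^sup>2)"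
      using h_sq law[OF i] integrable_distr_eq[of "X i" M N "\<lambda>z. (h z)\<^sup>2"] by simp
    show "expectation (\<lambda>x. h (X i x)) = (\<integral>z. h z \<partial>Q)"
      using law[OF i] integral_distr[of "X i" M N h] by simp
    show "expectation (\<lambda>x. (h (X i x))\<^sup>2) \<le> (\<integral>z. (h z)\<^sup>2 \<partial>Q)"
      using law[OF i] integral_distr[of "X i" M N "\<lambda>z. (h z)\<^sup>2"] by simp
  qed (use nonneg in auto)
  have int: "integrable Q g"
    by (rule Q.square_integrable_imp_integrable[OF _ sq]) simp
  have pos_sq: "integrable Q (\<lambda>z. (max 0 (g z))\<^sup>2)" and neg_sq: "integrable Q (\<lambda>z. (max 0 (- g z))\<^sup>2)"
    by (rule Bochner_Integration.integrable_bound[OF sq]; simp add: max_def)+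
  have split: "(\<integral>z. g z \<partial>Q) = (\<integral>z. max 0 (g z) \<partial>Q) - (\<integral>z. max 0 (- g z) \<partial>Q)"
  proof (subst Bochner_Integration.integral_diff[symmetric])
    show "(\<integral>z. g z \<partial>Q) = (\<integral>z. max 0 (g z) - max 0 (- g z) \<partial>Q)"
      by (intro Bochner_Integration.integral_cong) auto
  qed (use int in auto)
  have "AE x in M. (\<lambda>n. (\<Sum>i=1..n. max 0 (g (X i x))) / real n) \<longlonglongrightarrow> (\<integral>z. max 0 (g z) \<partial>Q)"
    by (rule nonneg_case[OF _ _ pos_sq]) auto
  moreover have "AE x in M. (\<lambda>n. (\<Sum>i=1..n. max 0 (- g (X i x))) / real n)
      \<longlonglongrightarrow> (\<integral>z. max 0 (- g z) \<partial>Q)"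
    by (rule nonneg_case[OF _ _ neg_sq]) auto
  ultimately show ?thesis
  proof eventually_elim
    case (elim x)
    have "(\<Sum>i=1..n. g (X i x)) / real n =
        (\<Sum>i=1..n. max 0 (g (X i x))) / real n - (\<Sum>i=1..n. max 0 (- g (X i x))) / real n" for n
      unfolding diff_divide_distrib[symmetric] sum_subtractf[symmetric]
      by (intro arg_cong2[where f = "(/)"] sum.cong) auto
    then show ?case unfolding split using tendsto_diff[OF elim] by simp
  qed
qed

text \<open>The least threshold is a measurable choice, because being a threshold is a countable
  conjunction of the events \<open>P n\<close>. Part (b) is therefore derived from a measurable
  sufficient condition, which avoids any measurability question about the inclusion of mean
  sets.\<close>

lemma eventually_AE_measurable_threshold:
  assumes [measurable]: "\<And>n::nat. Measurable.pred M (P n)"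
    and "AE \<omega> in M. \<forall>\<^sub>F n in sequentially. P n \<omega>"
  shows "\<exists>N \<in> M \<rightarrow>\<^sub>M count_space UNIV. \<exists>\<Omega> \<in> null_sets M.
    (\<forall>\<omega>\<in>space M. 1 \<le> N \<omega>) \<and> (\<forall>\<omega>\<in>space M - \<Omega>. \<forall>n\<ge>N \<omega>. P n \<omega>)"
proof -
  obtain \<Omega> where \<Omega>: "\<Omega> \<in> null_sets M"
      "\<And>\<omega>. \<omega> \<in> space M - \<Omega> \<Longrightarrow> \<forall>\<^sub>F n in sequentially. P n \<omega>"
    using AE_E3[OF assms(2)] by blast
  \<comment> \<open>\<open>LEAST\<close> is unspecified where no threshold exists; those points lie in \<open>\<Omega>\<close>.\<close>
  define N where "N \<omega> = Suc (LEAST k. \<forall>n\<in>{k..}. P n \<omega>)" for \<omega>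
  have "N \<in> M \<rightarrow>\<^sub>M count_space UNIV"
    unfolding N_def by measurable
  moreover have "P n \<omega>" if "\<omega> \<in> space M - \<Omega>" "n \<ge> N \<omega>" for \<omega> n
  proof -
    have "\<exists>k. \<forall>n\<in>{k..}. P n \<omega>"
      using \<Omega>(2)[OF that(1)] by (auto simp: eventually_sequentially)
    then have "\<forall>n\<in>{(LEAST k. \<forall>n\<in>{k..}. P n \<omega>)..}. P n \<omega>"
      by (rule LeastI_ex)
    moreover have "n \<in> {(LEAST k. \<forall>n\<in>{k..}. P n \<omega>)..}"
      using that(2) unfolding N_def atLeast_iff by (rule Suc_leD)
    ultimately show ?thesis by (rule bspec)
  qed
  moreover have "\<forall>\<omega>\<in>space M. 1 \<le> N \<omega>"
    by (simp add: N_def)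
  ultimately show ?thesis
    using \<Omega>(1) by blast
qed

subsection \<open>The metric space of unlabeled networks\<close>

text \<open>Factor the difference of squares and apply the triangle inequality to each factor. The
  bound is only linear in \<open>d y z\<close>, which later gives square integrability of the
  excess.\<close>

lemma (in Metric_space) mdist_square_diff_le:
  assumes "x \<in> M" "y \<in> M" "z \<in> M"
  shows "\<bar>(d x z)\<^sup>2 - (d y z)\<^sup>2\<bar> \<le> d x y * (d x y + 2 * d y z)"
proof -
  have "\<bar>(d x z)\<^sup>2 - (d y z)\<^sup>2\<bar> = \<bar>d x z - d y z\<bar> * (d x z + d y z)"
    by (simp add: power2_eq_square square_diff_square_factored abs_mult mult.commute)
  also have "\<dots> \<le> d x y * (d x y + 2 * d y z)"
  proof (rule mult_mono)
    show "\<bar>d x z - d y z\<bar> \<le> d x y"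
      using mdist_reverse_triangle[of x z y] assms by (simp add: commute)
    show "d x z + d y z \<le> d x y + 2 * d y z"
      using triangle[of x y z] assms by simp
  qed simp_all
  finally show ?thesis .
qed

text \<open>The squared reverse triangle inequality, expanded so that it can be integrated or summed
  over \<open>z\<close> term by term. Its growth in \<open>d x y\<close> is the source of
  coercivity.\<close>

lemma (in Metric_space) mdist_square_ge:
  assumes "x \<in> M" "y \<in> M" "z \<in> M"
  shows "(d x y)\<^sup>2 - 2 * d x y * d y z + (d y z)\<^sup>2 \<le> (d x z)\<^sup>2"
proof -
  have "\<bar>d x y - d y z\<bar> \<le> d x z"
    using mdist_reverse_triangle[of x y z] assms by simp
  then have "(d x y - d y z)\<^sup>2 \<le> (d x z)\<^sup>2"
    by (rule abs_le_square_iff[THEN iffD1, OF order_trans]) simp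
  then show ?thesis by (simp add: power2_diff algebra_simps)
qed

interpretation net: Metric_space "unlabeled_networks d" "procrustes_dist d" for d
  by (rule Metric_space_procrustes)

text \<open>The Euclidean topology of the orthant in product form, so that boxes are compact by
  \<open>compactin_PiE\<close>.\<close>

abbreviation labeled_topology :: "nat \<Rightarrow> (nat set \<Rightarrow> real) topology" where
  "labeled_topology d \<equiv>
     subtopology (product_topology (\<lambda>_. euclideanreal) (edges d)) (labeled_networks d)"

lemma topspace_labeled_topology: "topspace (labeled_topology d) = labeled_networks d"
  by (auto simp: labeled_networks_def PiE_def)

text \<open>The quotient map is 1-Lipschitz: the Procrustean distance is a minimum over
  representatives, so any two given representatives bound it.\<close>

lemma continuous_map_net_class: "continuous_map (labeled_topology d) (network_topology d) (net_class d)"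
  unfolding network_topology_def net.continuous_map_to_metric topspace_labeled_topology
proof (intro ballI allI impI)
  fix x and \<epsilon> :: real
  assume x: "x \<in> labeled_networks d" and "\<epsilon> > 0"
  let ?U = "{y \<in> topspace (labeled_topology d). edge_dist d x y \<in> {..<\<epsilon>}}"
  have "continuous_map (labeled_topology d) euclideanreal (edge_dist d x)"
    unfolding edge_dist_def[abs_def]
    by (intro continuous_intros finite_edges) auto
  then have "openin (labeled_topology d) ?U"
    by (rule openin_continuous_map_preimage) simp
  moreover have "x \<in> ?U"
    unfolding topspace_labeled_topology using x \<open>\<epsilon> > 0\<close> edge_dist_eq_0[OF x x] by simp
  moreover have "net_class d y \<in> net.mball d (net_class d x) \<epsilon>" if "y \<in> ?U" for y
  proof -
    have y: "y \<in> labeled_networks d" "edge_dist d x y < \<epsilon>"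
      using that unfolding topspace_labeled_topology by auto
    have cl: "net_class d x \<in> unlabeled_networks d" "net_class d y \<in> unlabeled_networks d"
      using x y by (auto simp: unlabeled_networks_def)
    have "procrustes_dist d (net_class d x) (net_class d y) \<le> edge_dist d x y"
      using procrustes_dist_le[OF cl] x y net_class_self by blast
    with y cl show ?thesis by simp
  qed
  ultimately show "\<exists>U. openin (labeled_topology d) U \<and> x \<in> U \<and>
      (\<forall>y\<in>U. net_class d y \<in> net.mball d (net_class d x) \<epsilon>)"
    by blast
qed

text \<open>Heine-Borel for the quotient: a closed ball is a closed subset of a finite union of
  continuous images of compact boxes.\<close>

lemma compactin_procrustes_mcball:
  assumes p: "p \<in> unlabeled_networks d"
  shows "compactin (network_topology d) (net.mcball d p r)"
proof (rule closed_compactin)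
  \<comment> \<open>The representative \<open>u\<close> of \<open>p\<close> that realizes the
    distance depends on the point of the ball, hence the union over all of the finite class
    \<open>p\<close>. Weights are nonnegative, so only the upper end of each box depends on
    \<open>r\<close>.\<close>
  let ?K = "\<Union>u\<in>p. net_class d ` (PiE (edges d) (\<lambda>e. {0..u e + r}))"
  have "compactin (labeled_topology d) (PiE (edges d) (\<lambda>e. {0..u e + r}))" for u :: "nat set \<Rightarrow> real"
    unfolding compactin_subtopology compactin_PiE labeled_networks_def by (auto intro!: PiE_mono)
  then have "compactin (network_topology d) (net_class d ` (PiE (edges d) (\<lambda>e. {0..u e + r})))" for u
    using image_compactin continuous_map_net_class by blast
  moreover have "finite p"
    using p finite_net_class by (auto simp: unlabeled_networks_def)
  ultimately show "compactin (network_topology d) ?K"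
    by (intro compactin_Union) auto
  show "net.mcball d p r \<subseteq> ?K"
  proof
    fix q assume "q \<in> net.mcball d p r"
    then have q: "q \<in> unlabeled_networks d" "procrustes_dist d p q \<le> r" by auto
    obtain u v where uv: "u \<in> p" "v \<in> q" "procrustes_dist d p q = edge_dist d u v"
      using procrustes_dist_attained[OF p q(1)] .
    have v: "v \<in> labeled_networks d" "q = net_class d v"
      using unlabeled_networks_memb[OF q(1) uv(2)] .
    have "v e \<le> u e + r" if "e \<in> edges d" for e
    proof -
      have "(u e - v e)\<^sup>2 \<le> (\<Sum>e\<in>edges d. (u e - v e)\<^sup>2)"
        using that finite_edges by (intro member_le_sum) auto
      then have "\<bar>u e - v e\<bar> \<le> edge_dist d u v"
        unfolding edge_dist_def by (intro real_le_rsqrt) simp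
      then show ?thesis using uv(3) q(2) by linarith
    qed
    with v(1) have "v \<in> PiE (edges d) (\<lambda>e. {0..u e + r})"
      by (auto simp: labeled_networks_def PiE_def Pi_def)
    then show "q \<in> ?K" using uv(1) v(2) by blast
  qed
  show "closedin (network_topology d) (net.mcball d p r)"
    by (simp add: network_topology_def)
qed

section \<open>Borel structure of the quotient\<close>

lemma unlabeled_networks_nonempty: "unlabeled_networks d \<noteq> {}"
  by (simp add: unlabeled_networks_def labeled_networks_def PiE_eq_empty_iff)

lemma topspace_network_topology: "topspace (network_topology d) = unlabeled_networks d"
  by (simp add: network_topology_def)

lemma network_opens_subset: "{U. openin (network_topology d) U} \<subseteq> Pow (unlabeled_networks d)"
  using openin_subset topspace_network_topology by blast

lemma space_network_borel: "space (network_borel d) = unlabeled_networks d"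
  unfolding network_borel_def by (rule space_measure_of[OF network_opens_subset])

lemma openin_sets_network_borel:
  "openin (network_topology d) U \<Longrightarrow> U \<in> sets (network_borel d)"
  unfolding network_borel_def sets_measure_of[OF network_opens_subset] by (rule sigma_sets.Basic) simp

text \<open>Strict sublevel sets of the distance to \<open>p\<close> are open balls.\<close>

lemma measurable_procrustes_dist:
  assumes "p \<in> unlabeled_networks d"
  shows "procrustes_dist d p \<in> borel_measurable (network_borel d)"
  unfolding borel_measurable_iff_less
proof
  fix a
  have "{w \<in> space (network_borel d). procrustes_dist d p w < a} = net.mball d p a"
    using assms by (auto simp: space_network_borel)
  then show "{w \<in> space (network_borel d). procrustes_dist d p w < a} \<in> sets (network_borel d)"
    using net.openin_mball[of d p a] openin_sets_network_borel by (simp add: network_topology_def)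
qed

subsection \<open>Frechet means\<close>

text \<open>Finiteness of the \<open>ennreal\<close>-valued Frechet function makes squared distances
  integrable, so inside the locale it can be replaced by the real integral
  \<open>frechet\<close>.\<close>

locale square_integrable_network_law = prob_space Q
  for Q :: "(nat set \<Rightarrow> real) set measure" +
  fixes d :: nat
  assumes sets_Q: "sets Q = sets (network_borel d)"
    and finite_frechet: "p \<in> unlabeled_networks d \<Longrightarrow> frechet_fun d Q p < \<infinity>"
begin

abbreviation frechet :: "(nat set \<Rightarrow> real) set \<Rightarrow> real" where
  "frechet p \<equiv> expectation (\<lambda>z. (procrustes_dist d p z)\<^sup>2)"

abbreviation mean_dist :: "(nat set \<Rightarrow> real) set \<Rightarrow> real" where
  "mean_dist p \<equiv> expectation (procrustes_dist d p)"

lemma space_Q: "space Q = unlabeled_networks d"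
  using sets_eq_imp_space_eq[OF sets_Q] by (simp add: space_network_borel)

lemma dist_measurable[measurable]:
  "p \<in> unlabeled_networks d \<Longrightarrow> procrustes_dist d p \<in> borel_measurable Q"
  using measurable_procrustes_dist by (simp add: measurable_cong_sets[OF sets_Q refl])

lemma dist_square_integrable:
  assumes p: "p \<in> unlabeled_networks d"
  shows "integrable Q (\<lambda>z. (procrustes_dist d p z)\<^sup>2)"
proof (rule integrableI_bounded)
  show "(\<lambda>z. (procrustes_dist d p z)\<^sup>2) \<in> borel_measurable Q"
    using p by measurable
qed (use finite_frechet[OF p] in \<open>simp add: frechet_fun_def\<close>)

lemma dist_integrable:
  assumes p: "p \<in> unlabeled_networks d"
  shows "integrable Q (procrustes_dist d p)"
  by (rule square_integrable_imp_integrable[OF dist_measurable[OF p] dist_square_integrable[OF p]])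

lemma mean_dist_nonneg: "0 \<le> mean_dist p"
  by (rule integral_nonneg_AE) simp

lemma frechet_mean_set_iff:
  "p \<in> frechet_mean_set d Q \<longleftrightarrow>
     p \<in> unlabeled_networks d \<and> (\<forall>q\<in>unlabeled_networks d. frechet p \<le> frechet q)"
proof -
  have "frechet_fun d Q p = ennreal (frechet p)" if "p \<in> unlabeled_networks d" for p
    unfolding frechet_fun_def by (rule nn_integral_eq_integral[OF dist_square_integrable[OF that]]) simp
  moreover have "0 \<le> frechet p" for p
    by (rule integral_nonneg_AE) simp
  ultimately show ?thesis
    by (auto simp: frechet_mean_set_def)
qed

text \<open>\<open>net.mdist_square_diff_le\<close> integrated over \<open>z\<close>; it serves as
  the modulus of continuity below.\<close>

lemma frechet_diff_le:
  assumes "p \<in> unlabeled_networks d" "q \<in> unlabeled_networks d"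
  shows "\<bar>frechet p - frechet q\<bar> \<le> procrustes_dist d p q * (procrustes_dist d p q + 2 * mean_dist q)"
proof -
  let ?c = "procrustes_dist d p q"
  note int = dist_square_integrable[OF assms(1)] dist_square_integrable[OF assms(2)]
    dist_integrable[OF assms(2)]
  have "\<bar>frechet p - frechet q\<bar> = \<bar>expectation (\<lambda>z. (procrustes_dist d p z)\<^sup>2 - (procrustes_dist d q z)\<^sup>2)\<bar>"
    using int by simp
  also have "\<dots> \<le> expectation (\<lambda>z. \<bar>(procrustes_dist d p z)\<^sup>2 - (procrustes_dist d q z)\<^sup>2\<bar>)"
    by (rule integral_abs_bound)
  also have "\<dots> \<le> expectation (\<lambda>z. ?c * (?c + 2 * procrustes_dist d q z))"
    using int assms net.mdist_square_diff_le by (intro integral_mono) (auto simp: space_Q)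
  also have "\<dots> = ?c * (?c + 2 * mean_dist q)"
    using int by (simp add: prob_space)
  finally show ?thesis .
qed

lemma continuous_map_frechet: "continuous_map (network_topology d) euclideanreal frechet"
  unfolding network_topology_def net.continuous_map_from_metric
proof (intro conjI ballI allI impI)
  fix q V
  assume q: "q \<in> unlabeled_networks d" and V: "openin euclideanreal V \<and> frechet q \<in> V"
  then obtain e where e: "e > 0" "ball (frechet q) e \<subseteq> V"
    by (metis open_contains_ball open_openin)
  \<comment> \<open>The entry 1 reduces \<open>?c + 2 * mean_dist q\<close> to
    \<open>1 + 2 * mean_dist q\<close>; the other entry then makes the product smaller than
    \<open>e\<close>.\<close>
  define r where "r = min 1 (e / (1 + 2 * mean_dist q))"
  have "frechet p \<in> V" if p: "p \<in> unlabeled_networks d" "procrustes_dist d q p < r" for p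
  proof -
    let ?c = "procrustes_dist d p q"
    have c: "?c < 1" "?c < e / (1 + 2 * mean_dist q)"
      using p(2) by (simp_all add: r_def net.commute)
    have "\<bar>frechet p - frechet q\<bar> \<le> ?c * (?c + 2 * mean_dist q)"
      by (rule frechet_diff_le[OF p(1) q])
    also have "\<dots> \<le> ?c * (1 + 2 * mean_dist q)"
      using c(1) by (intro mult_left_mono) auto
    also have "\<dots> < e"
      using c(2) mean_dist_nonneg[of q] by (simp add: pos_less_divide_eq)
    finally show ?thesis using e(2) by (auto simp: dist_real_def abs_minus_commute)
  qed
  moreover have "r > 0"
    unfolding r_def using e(1) mean_dist_nonneg[of q]
    by (intro min_less_iff_conj[THEN iffD2] conjI divide_pos_pos) linarith+
  ultimately show "\<exists>r>0. \<forall>x. x \<in> unlabeled_networks d \<and> procrustes_dist d q x < r \<longrightarrow> frechet x \<in> V"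
    by blast
qed simp

text \<open>Coercivity: integrating \<open>net.mdist_square_ge\<close> and cancelling
  \<open>frechet q\<close> leaves c^2 <= 2 c \<open>mean_dist q\<close> for c =
  \<open>procrustes_dist d p q\<close>. Divide by c unless it is 0.\<close>

lemma frechet_sublevel_bounded:
  assumes pq: "p \<in> unlabeled_networks d" "q \<in> unlabeled_networks d" and le: "frechet p \<le> frechet q"
  shows "procrustes_dist d p q \<le> 2 * mean_dist q"
proof -
  let ?c = "procrustes_dist d p q"
  note int = dist_square_integrable[OF pq(1)] dist_square_integrable[OF pq(2)]
    dist_integrable[OF pq(2)]
  have "?c\<^sup>2 - 2 * ?c * mean_dist q + frechet q =
      expectation (\<lambda>z. ?c\<^sup>2 - 2 * ?c * procrustes_dist d q z + (procrustes_dist d q z)\<^sup>2)"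
    using int by (simp add: prob_space)
  also have "\<dots> \<le> frechet p"
    using int pq net.mdist_square_ge by (intro integral_mono) (auto simp: space_Q)
  finally have "?c * ?c \<le> ?c * (2 * mean_dist q)"
    using le by (simp add: power2_eq_square)
  then show ?thesis
    using mean_dist_nonneg[of q] net.nonneg[of d p q] by (cases "?c = 0") (auto simp: mult_le_cancel_left)
qed

text \<open>A continuous function attains its minimum on a compact ball about an arbitrary
  \<open>q\<close>; by coercivity every point outside that ball has a larger value than
  \<open>q\<close>.\<close>

lemma frechet_mean_set_nonempty: "frechet_mean_set d Q \<noteq> {}"
proof -
  obtain q where q: "q \<in> unlabeled_networks d"
    using unlabeled_networks_nonempty by blast
  let ?K = "net.mcball d q (2 * mean_dist q)"
  have "compact (frechet ` ?K)"
    using image_compactin[OF compactin_procrustes_mcball[OF q] continuous_map_frechet] by simp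
  moreover have "q \<in> ?K"
    using q mean_dist_nonneg by simp
  ultimately obtain p where p: "p \<in> ?K" "\<And>p'. p' \<in> ?K \<Longrightarrow> frechet p \<le> frechet p'"
    using compact_attains_inf[of "frechet ` ?K"] by blast
  have "frechet p \<le> frechet p'" if p': "p' \<in> unlabeled_networks d" for p'
  proof (cases "frechet p' \<le> frechet q")
    case True
    then have "p' \<in> ?K"
      using frechet_sublevel_bounded[OF p' q] p' q by (simp add: net.commute)
    then show ?thesis by (rule p(2))
  next
    case False
    then show ?thesis using p(2)[OF \<open>q \<in> ?K\<close>] by simp
  qed
  then show ?thesis using p(1) frechet_mean_set_iff by auto
qed

lemma compactin_frechet_mean_set: "compactin (network_topology d) (frechet_mean_set d Q)"
proof -
  obtain q where q: "q \<in> frechet_mean_set d Q"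
    using frechet_mean_set_nonempty by blast
  then have qU: "q \<in> unlabeled_networks d"
    by (simp add: frechet_mean_set_iff)
  \<comment> \<open>With \<open>q\<close> a minimizer, the mean set is the sublevel set at the
    minimal value, hence closed.\<close>
  have eq: "frechet_mean_set d Q = {p \<in> topspace (network_topology d). frechet p \<in> {..frechet q}}"
    using q by (force simp: frechet_mean_set_iff topspace_network_topology)
  show ?thesis
  proof (rule closed_compactin[OF compactin_procrustes_mcball[OF qU]])
    show "frechet_mean_set d Q \<subseteq> net.mcball d q (2 * mean_dist q)"
    proof
      fix p assume "p \<in> frechet_mean_set d Q"
      then have p: "p \<in> unlabeled_networks d" "frechet p \<le> frechet q"
        using qU by (auto simp: frechet_mean_set_iff)
      with frechet_sublevel_bounded[OF p(1) qU p(2)] qU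
      show "p \<in> net.mcball d q (2 * mean_dist q)"
        by (simp add: net.commute)
    qed
    show "closedin (network_topology d) (frechet_mean_set d Q)"
      unfolding eq by (rule closedin_continuous_map_preimage[OF continuous_map_frechet]) simp
  qed
qed

end

subsection \<open>Consistency of empirical Frechet means\<close>

text \<open>The sample counterpart of \<open>frechet_sublevel_bounded\<close>, with sums in place of
  integrals; it holds for each fixed sample.\<close>

lemma empirical_mean_dist_le:
  assumes n: "n \<ge> 1" and x: "\<And>i. i \<ge> 1 \<Longrightarrow> x i \<in> unlabeled_networks d"
    and q: "q \<in> unlabeled_networks d" and p: "p \<in> empirical_frechet_mean_set d n x"
  shows "procrustes_dist d p q \<le> 2 * ((\<Sum>i=1..n. procrustes_dist d q (x i)) / real n)"
proof -
  let ?c = "procrustes_dist d p q"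
  let ?D = "\<Sum>i=1..n. procrustes_dist d q (x i)"
  have pU: "p \<in> unlabeled_networks d"
    and le: "empirical_frechet_fun d n x p \<le> empirical_frechet_fun d n x q"
    using p q by (auto simp: empirical_frechet_mean_set_def)
  have "(\<Sum>i=1..n. ?c\<^sup>2 - 2 * ?c * procrustes_dist d q (x i) + (procrustes_dist d q (x i))\<^sup>2)
      \<le> (\<Sum>i=1..n. (procrustes_dist d p (x i))\<^sup>2)"
    using pU q x by (intro sum_mono net.mdist_square_ge) auto
  also have "\<dots> \<le> (\<Sum>i=1..n. (procrustes_dist d q (x i))\<^sup>2)"
    using le n by (simp add: empirical_frechet_fun_def divide_le_cancel)
  finally have "real n * ?c\<^sup>2 - 2 * ?c * ?D \<le> 0"
    by (simp add: sum.distrib sum_subtractf sum_distrib_left)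
  then have "?c * (real n * ?c) \<le> ?c * (2 * ?D)"
    by (simp add: power2_eq_square algebra_simps)
  moreover have "0 \<le> ?D" by (intro sum_nonneg) simp
  ultimately have "real n * ?c \<le> 2 * ?D"
    using net.nonneg[of d p q] by (cases "?c = 0") (auto simp: mult_le_cancel_left)
  then show ?thesis using n by (simp add: field_simps)
qed

text \<open>Since \<open>p\<close> minimizes, the empirical excess of \<open>q\<close> over
  \<open>\<mu>\<close> is at most that of \<open>q\<close> over \<open>p\<close>, which is small
  when \<open>p\<close> is close to \<open>q\<close>. Used contrapositively: a point with large
  empirical excess has no empirical mean nearby.\<close>

lemma empirical_frechet_excess_le:
  assumes n: "n \<ge> 1" and x: "\<And>i. i \<ge> 1 \<Longrightarrow> x i \<in> unlabeled_networks d"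
    and q: "q \<in> unlabeled_networks d" and \<mu>: "\<mu> \<in> unlabeled_networks d"
    and p: "p \<in> empirical_frechet_mean_set d n x"
    and D: "(\<Sum>i=1..n. procrustes_dist d \<mu> (x i)) / real n \<le> R"
  shows "(\<Sum>i=1..n. (procrustes_dist d q (x i))\<^sup>2 - (procrustes_dist d \<mu> (x i))\<^sup>2) / real n
    \<le> procrustes_dist d p q * (procrustes_dist d p q + 6 * R)"
proof -
  let ?c = "procrustes_dist d p q"
  let ?D = "\<Sum>i=1..n. procrustes_dist d \<mu> (x i)"
  have pU: "p \<in> unlabeled_networks d"
    and le: "empirical_frechet_fun d n x p \<le> empirical_frechet_fun d n x \<mu>"
    using p \<mu> by (auto simp: empirical_frechet_mean_set_def)
  have p\<mu>: "procrustes_dist d p \<mu> \<le> 2 * R"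
    using empirical_mean_dist_le[OF n x \<mu> p] D by simp
  \<comment> \<open>Here \<open>4 * R\<close> is twice the bound \<open>p\<mu>\<close>. Averaging
    the last summand by means of \<open>D\<close> contributes another \<open>2 * R\<close>, whence
    the constant 6.\<close>
  have sq_le: "(procrustes_dist d q (x i))\<^sup>2 - (procrustes_dist d p (x i))\<^sup>2
      \<le> ?c * (?c + 4 * R + 2 * procrustes_dist d \<mu> (x i))" if i: "i \<ge> 1" for i
  proof -
    have "\<bar>(procrustes_dist d q (x i))\<^sup>2 - (procrustes_dist d p (x i))\<^sup>2\<bar>
        \<le> ?c * (?c + 2 * procrustes_dist d p (x i))"
      using net.mdist_square_diff_le[OF q pU x[OF i]] by (simp add: net.commute[of d q p])
    also have "\<dots> \<le> ?c * (?c + 4 * R + 2 * procrustes_dist d \<mu> (x i))"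
      using net.triangle[OF pU \<mu> x[OF i]] p\<mu> by (intro mult_left_mono) auto
    finally show ?thesis by simp
  qed
  have "(\<Sum>i=1..n. (procrustes_dist d q (x i))\<^sup>2 - (procrustes_dist d \<mu> (x i))\<^sup>2)
      \<le> (\<Sum>i=1..n. (procrustes_dist d q (x i))\<^sup>2 - (procrustes_dist d p (x i))\<^sup>2)"
    using le n by (simp add: empirical_frechet_fun_def divide_le_cancel sum_subtractf)
  also have "\<dots> \<le> (\<Sum>i=1..n. ?c * (?c + 4 * R + 2 * procrustes_dist d \<mu> (x i)))"
    by (intro sum_mono sq_le) auto
  also have "\<dots> = ?c * (real n * (?c + 4 * R) + 2 * ?D)"
    by (simp add: sum_distrib_left[symmetric] sum.distrib)
  also have "\<dots> \<le> ?c * (real n * (?c + 6 * R))"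
    using D n by (intro mult_left_mono) (auto simp: field_simps)
  finally show ?thesis
    using n by (simp add: field_simps)
qed

section \<open>From finitely many comparison points to almost sure consistency\<close>

context square_integrable_network_law
begin

text \<open>Compactness yields a finite set \<open>A\<close> that does not depend on the sample.
  Every far point of the ball has a point of \<open>A\<close> so near that the bound of
  \<open>empirical_frechet_excess_le\<close> is at most half of the population excess there.\<close>

lemma finite_comparison_points:
  assumes \<mu>: "\<mu> \<in> frechet_mean_set d Q" and "\<epsilon> > 0" and "R \<ge> 0"
  obtains A where "finite A" and "A \<subseteq> unlabeled_networks d"
    and "\<And>q. q \<in> A \<Longrightarrow> frechet \<mu> < frechet q"
    and "\<And>p. p \<in> net.mcball d \<mu> (2 * R) \<Longrightarrow> p \<notin> procrustes_nbhd d \<epsilon> (frechet_mean_set d Q) \<Longrightarrow>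
      \<exists>q\<in>A. procrustes_dist d p q * (procrustes_dist d p q + 6 * R) \<le> (frechet q - frechet \<mu>) / 2"
proof -
  let ?C = "frechet_mean_set d Q"
  \<comment> \<open>Removing open balls about all means keeps \<open>K\<close> closed in a compact
    ball and disjoint from the mean set, so the excess is positive on it.\<close>
  define K where "K = net.mcball d \<mu> (2 * R) - (\<Union>q\<in>?C. net.mball d q \<epsilon>)"
  \<comment> \<open>Below 1 the bound c (c + 6 R) is at most c (1 + 6 R); the second entry makes
    this at most half of the excess at \<open>q\<close>.\<close>
  define \<delta> where "\<delta> q = min 1 ((frechet q - frechet \<mu>) / (2 * (1 + 6 * R)))" for q
  have \<mu>U: "\<mu> \<in> unlabeled_networks d"
    using \<mu> by (simp add: frechet_mean_set_iff)
  have "compactin (network_topology d) K"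
  proof (rule closed_compactin[OF compactin_procrustes_mcball[OF \<mu>U]])
    show "closedin (network_topology d) K"
      unfolding K_def network_topology_def by (intro closedin_diff openin_Union) auto
  qed (auto simp: K_def)
  have K_gt: "frechet \<mu> < frechet q" if "q \<in> K" for q
  proof (rule ccontr)
    assume "\<not> frechet \<mu> < frechet q"
    moreover have qU: "q \<in> unlabeled_networks d"
      using that by (auto simp: K_def)
    ultimately have "q \<in> ?C"
      using \<mu> by (force simp: frechet_mean_set_iff)
    then show False
      using that qU \<open>\<epsilon> > 0\<close> by (auto simp: K_def)
  qed
  then have \<delta>_pos: "0 < \<delta> q" if "q \<in> K" for q
    unfolding \<delta>_def using that \<open>R \<ge> 0\<close>
    by (intro min_less_iff_conj[THEN iffD2] conjI divide_pos_pos) auto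
  have "K \<subseteq> \<Union>((\<lambda>q. net.mball d q (\<delta> q)) ` K)"
    using \<delta>_pos by (auto simp: K_def)
  then obtain F where F: "finite F" "F \<subseteq> (\<lambda>q. net.mball d q (\<delta> q)) ` K" "K \<subseteq> \<Union>F"
    using compactinD[OF \<open>compactin (network_topology d) K\<close>, of "(\<lambda>q. net.mball d q (\<delta> q)) ` K"]
    by (auto simp: network_topology_def)
  then obtain A where A: "finite A" "A \<subseteq> K" "F = (\<lambda>q. net.mball d q (\<delta> q)) ` A"
    by (meson finite_subset_image)
  show ?thesis
  proof
    show "finite A" "A \<subseteq> unlabeled_networks d"
      using A by (auto simp: K_def)
    show "frechet \<mu> < frechet q" if "q \<in> A" for q
      using K_gt A(2) that by blast
    fix p assume p: "p \<in> net.mcball d \<mu> (2 * R)" "p \<notin> procrustes_nbhd d \<epsilon> ?C"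
    have pU: "p \<in> unlabeled_networks d"
      using p(1) by simp
    have "p \<notin> net.mball d q \<epsilon>" if q: "q \<in> ?C" for q
    proof
      assume "p \<in> net.mball d q \<epsilon>"
      then have "procrustes_dist d p q < \<epsilon>"
        by (simp add: net.commute)
      moreover have "procrustes_setdist d p ?C \<le> procrustes_dist d p q"
        unfolding procrustes_setdist_def using q by (intro cINF_lower bdd_belowI2[where m = 0]) auto
      ultimately show False
        using p(2) pU by (simp add: procrustes_nbhd_def)
    qed
    then have "p \<in> K"
      using p(1) by (auto simp: K_def)
    then obtain q where q: "q \<in> A" "p \<in> net.mball d q (\<delta> q)"
      using F(3) A(3) by blast
    let ?c = "procrustes_dist d p q"
    have c: "?c < 1" "?c < (frechet q - frechet \<mu>) / (2 * (1 + 6 * R))"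
      using q(2) by (simp_all add: \<delta>_def net.commute)
    have "?c * (?c + 6 * R) \<le> ?c * (1 + 6 * R)"
      using c(1) by (intro mult_left_mono) auto
    also have "\<dots> \<le> (frechet q - frechet \<mu>) / 2"
      using c(2) \<open>R \<ge> 0\<close> by (simp add: field_simps)
    finally show "\<exists>q\<in>A. procrustes_dist d p q * (procrustes_dist d p q + 6 * R) \<le> (frechet q - frechet \<mu>) / 2"
      using q(1) by blast
  qed
qed

text \<open>The excess is bounded by a linear function of the distance, so its square is dominated
  by a quadratic one, which is integrable by finite second moments. No fourth moment of the distance
  enters.\<close>

lemma square_diff_square_integrable:
  assumes "p \<in> unlabeled_networks d" "q \<in> unlabeled_networks d"
  shows "integrable Q (\<lambda>z. ((procrustes_dist d p z)\<^sup>2 - (procrustes_dist d q z)\<^sup>2)\<^sup>2)"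
proof -
  let ?c = "procrustes_dist d p q"
  note [measurable] = dist_measurable[OF assms(1)] dist_measurable[OF assms(2)]
  have "integrable Q (\<lambda>z. (?c * (?c + 2 * procrustes_dist d q z))\<^sup>2)"
    using dist_integrable[OF assms(2)] dist_square_integrable[OF assms(2)]
    by (simp add: power_mult_distrib power2_sum)
  then show ?thesis
  proof (rule Bochner_Integration.integrable_bound)
    show "AE z in Q. norm (((procrustes_dist d p z)\<^sup>2 - (procrustes_dist d q z)\<^sup>2)\<^sup>2)
        \<le> norm ((?c * (?c + 2 * procrustes_dist d q z))\<^sup>2)"
      using net.mdist_square_diff_le[OF assms]
      by (intro AE_I2) (auto simp: space_Q power2_abs intro!: abs_le_square_iff[THEN iffD1] order_trans[OF _ abs_ge_self])
  qed measurable
qed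

text \<open>The strong law for the distance to one mean \<open>\<mu>\<close> confines the empirical
  means to a fixed ball; the strong law for the excess at each point of \<open>A\<close> keeps them
  away from the far part of that ball.\<close>

lemma empirical_mean_sets_eventually_in_nbhd:
  fixes M :: "'w measure" and X :: "nat \<Rightarrow> 'w \<Rightarrow> (nat set \<Rightarrow> real) set"
  assumes M: "prob_space M"
    and indep: "prob_space.indep_vars M (\<lambda>_. network_borel d) X {1..}"
    and law: "\<forall>i\<ge>1. distr M (network_borel d) (X i) = Q"
    and "\<epsilon> > 0"
  shows "\<exists>N \<in> M \<rightarrow>\<^sub>M count_space UNIV. \<exists>\<Omega> \<in> null_sets M.
    (\<forall>\<omega>\<in>space M. 1 \<le> (N \<omega> :: nat)) \<and>
    (\<forall>\<omega>\<in>space M - \<Omega>. \<forall>n\<ge>N \<omega>.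
       empirical_frechet_mean_set d n (\<lambda>i. X i \<omega>) \<subseteq> procrustes_nbhd d \<epsilon> (frechet_mean_set d Q))"
proof -
  interpret M: prob_space M by (rule M)
  have X[measurable]: "X i \<in> M \<rightarrow>\<^sub>M network_borel d" if "i \<ge> 1" for i
    using indep that by (simp add: M.indep_vars_def)
  have XU: "X i \<omega> \<in> unlabeled_networks d" if "i \<ge> 1" "\<omega> \<in> space M" for i \<omega>
    using measurable_space[OF X[OF that(1)] that(2)] by (simp add: space_network_borel)
  obtain \<mu> where \<mu>: "\<mu> \<in> frechet_mean_set d Q"
    using frechet_mean_set_nonempty by blast
  then have \<mu>U: "\<mu> \<in> unlabeled_networks d"
    by (simp add: frechet_mean_set_iff)
  \<comment> \<open>The surplus 1 ensures that the averages \<open>Dn\<close>, which converge to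
    \<open>mean_dist \<mu>\<close>, are eventually below \<open>R\<close>.\<close>
  define R where "R = mean_dist \<mu> + 1"
  have "R \<ge> 0"
    using mean_dist_nonneg[of \<mu>] unfolding R_def by linarith
  obtain A where A: "finite A" "A \<subseteq> unlabeled_networks d"
    and A_gt: "\<And>q. q \<in> A \<Longrightarrow> frechet \<mu> < frechet q"
    and A_near: "\<And>p. p \<in> net.mcball d \<mu> (2 * R) \<Longrightarrow>
      p \<notin> procrustes_nbhd d \<epsilon> (frechet_mean_set d Q) \<Longrightarrow>
      \<exists>q\<in>A. procrustes_dist d p q * (procrustes_dist d p q + 6 * R) \<le> (frechet q - frechet \<mu>) / 2"
    using finite_comparison_points[OF \<mu> \<open>\<epsilon> > 0\<close> \<open>R \<ge> 0\<close>] by metis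
  define Dn where "Dn n \<omega> = (\<Sum>i=1..n. procrustes_dist d \<mu> (X i \<omega>)) / real n" for n \<omega>
  define Hn where "Hn q n \<omega> =
    (\<Sum>i=1..n. (procrustes_dist d q (X i \<omega>))\<^sup>2 - (procrustes_dist d \<mu> (X i \<omega>))\<^sup>2) / real n" for q n \<omega>
  \<comment> \<open>A measurable condition that forces the inclusion. Half of the excess is a strict
    lower bound eventually, because \<open>Hn q n\<close> tends to the full positive excess.\<close>
  define P where "P n \<omega> \<longleftrightarrow> 1 \<le> n \<and> Dn n \<omega> < R \<and> (\<forall>q\<in>A. (frechet q - frechet \<mu>) / 2 < Hn q n \<omega>)"
    for n \<omega>
  have dist_X: "(\<lambda>\<omega>. procrustes_dist d q (X i \<omega>)) \<in> borel_measurable M"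
    if "q \<in> unlabeled_networks d" "i \<ge> 1" for q i
    using measurable_compose[OF X[OF that(2)] measurable_procrustes_dist[OF that(1)]] .
  have [measurable]: "Dn n \<in> borel_measurable M" for n
    unfolding Dn_def[abs_def] by (intro borel_measurable_divide borel_measurable_sum dist_X \<mu>U) auto
  have Hn_meas: "Hn q n \<in> borel_measurable M" if "q \<in> A" for q n
    unfolding Hn_def[abs_def] using A(2) that
    by (intro borel_measurable_divide borel_measurable_sum borel_measurable_diff
        borel_measurable_power dist_X \<mu>U) auto
  have P_meas: "Measurable.pred M (P n)" for n
  proof -
    have "Measurable.pred M (\<lambda>\<omega>. (frechet q - frechet \<mu>) / 2 < Hn q n \<omega>)" if "q \<in> A" for q
      using Hn_meas[OF that, of n] by measurable
    then have [measurable]: "Measurable.pred M (\<lambda>\<omega>. \<forall>q\<in>A. (frechet q - frechet \<mu>) / 2 < Hn q n \<omega>)"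
      by (rule pred_intros_finite(3)[OF A(1)])
    show ?thesis unfolding P_def[abs_def] by measurable
  qed
  have "AE \<omega> in M. (\<lambda>n. Dn n \<omega>) \<longlonglongrightarrow> mean_dist \<mu>"
    unfolding Dn_def
    by (rule M.strong_law_square_integrable[OF indep _ measurable_procrustes_dist[OF \<mu>U]
          dist_square_integrable[OF \<mu>U]]) (use law in blast)
  moreover have "AE \<omega> in M. \<forall>q\<in>A. (\<lambda>n. Hn q n \<omega>) \<longlonglongrightarrow> frechet q - frechet \<mu>"
  proof (rule AE_finite_allI[OF A(1)])
    fix q assume "q \<in> A"
    then have qU: "q \<in> unlabeled_networks d"
      using A(2) by blast
    note [measurable] = measurable_procrustes_dist[OF qU] measurable_procrustes_dist[OF \<mu>U]
    have "AE \<omega> in M. (\<lambda>n. Hn q n \<omega>) \<longlonglongrightarrow>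
        expectation (\<lambda>z. (procrustes_dist d q z)\<^sup>2 - (procrustes_dist d \<mu> z)\<^sup>2)"
      unfolding Hn_def
      by (rule M.strong_law_square_integrable[OF indep _ _ square_diff_square_integrable[OF qU \<mu>U]])
        (use law in blast, measurable)
    then show "AE \<omega> in M. (\<lambda>n. Hn q n \<omega>) \<longlonglongrightarrow> frechet q - frechet \<mu>"
      using dist_square_integrable[OF qU] dist_square_integrable[OF \<mu>U] by simp
  qed
  ultimately have "AE \<omega> in M. \<forall>\<^sub>F n in sequentially. P n \<omega>"
  proof eventually_elim
    case (elim \<omega>)
    have "\<forall>\<^sub>F n in sequentially. Dn n \<omega> < R"
      by (rule order_tendstoD(2)[OF elim(1)]) (simp add: R_def)
    moreover have "\<forall>\<^sub>F n in sequentially. \<forall>q\<in>A. (frechet q - frechet \<mu>) / 2 < Hn q n \<omega>"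
    proof (intro eventually_ball_finite A(1) ballI)
      fix q assume q: "q \<in> A"
      have half: "a / 2 < a" if "0 < a" for a :: real
        using that by simp
      have "(frechet q - frechet \<mu>) / 2 < frechet q - frechet \<mu>"
        by (rule half) (use A_gt[OF q] in simp)
      then show "\<forall>\<^sub>F n in sequentially. (frechet q - frechet \<mu>) / 2 < Hn q n \<omega>"
        using order_tendstoD(1) elim(2) q by blast
    qed
    ultimately show ?case
      using eventually_ge_at_top[of 1] unfolding P_def by eventually_elim blast
  qed
  from eventually_AE_measurable_threshold[OF P_meas this]
  obtain N \<Omega> where N: "N \<in> M \<rightarrow>\<^sub>M count_space UNIV" "\<Omega> \<in> null_sets M" "\<forall>\<omega>\<in>space M. 1 \<le> N \<omega>"
      "\<forall>\<omega>\<in>space M - \<Omega>. \<forall>n\<ge>N \<omega>. P n \<omega>"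
    by blast
  \<comment> \<open>The deterministic core: an empirical mean outside the neighbourhood would have a
    nearby \<open>q\<close> in \<open>A\<close> whose empirical excess is at most half of the
    population excess, against \<open>P\<close>.\<close>
  have "empirical_frechet_mean_set d n (\<lambda>i. X i \<omega>) \<subseteq> procrustes_nbhd d \<epsilon> (frechet_mean_set d Q)"
    if \<omega>: "\<omega> \<in> space M" and "P n \<omega>" for n \<omega>
  proof (rule subsetI, rule ccontr)
    fix p assume p: "p \<in> empirical_frechet_mean_set d n (\<lambda>i. X i \<omega>)"
      and out: "p \<notin> procrustes_nbhd d \<epsilon> (frechet_mean_set d Q)"
    have n: "n \<ge> 1" and D: "Dn n \<omega> \<le> R"
      and H: "\<And>q. q \<in> A \<Longrightarrow> (frechet q - frechet \<mu>) / 2 < Hn q n \<omega>"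
      using \<open>P n \<omega>\<close> by (auto simp: P_def)
    have x: "\<And>i. i \<ge> 1 \<Longrightarrow> X i \<omega> \<in> unlabeled_networks d"
      using XU \<omega> by blast
    have pU: "p \<in> unlabeled_networks d"
      using p by (simp add: empirical_frechet_mean_set_def)
    have "procrustes_dist d p \<mu> \<le> 2 * R"
      using empirical_mean_dist_le[OF n x \<mu>U p] D unfolding Dn_def by linarith
    then have "p \<in> net.mcball d \<mu> (2 * R)"
      using pU \<mu>U by (simp add: net.commute)
    then obtain q where q: "q \<in> A"
      "procrustes_dist d p q * (procrustes_dist d p q + 6 * R) \<le> (frechet q - frechet \<mu>) / 2"
      using A_near out by blast
    have "Hn q n \<omega> \<le> procrustes_dist d p q * (procrustes_dist d p q + 6 * R)"
      unfolding Hn_def using A(2) q(1) D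
      by (intro empirical_frechet_excess_le[OF n x _ \<mu>U p]) (auto simp: Dn_def)
    then show False
      using q(2) H[OF q(1)] by linarith
  qed
  then have "\<forall>\<omega>\<in>space M - \<Omega>. \<forall>n\<ge>N \<omega>. empirical_frechet_mean_set d n (\<lambda>i. X i \<omega>)
      \<subseteq> procrustes_nbhd d \<epsilon> (frechet_mean_set d Q)"
    using N(4) by simp
  with N(1-3) show ?thesis
    by (intro bexI[of _ N] bexI[of _ \<Omega>] conjI)
qed

end

theorem theorem3p2:
  fixes d :: nat
    and Q :: "(nat set \<Rightarrow> real) set measure"
    and M :: "'w measure"
    and X :: "nat \<Rightarrow> 'w \<Rightarrow> (nat set \<Rightarrow> real) set"
  assumes "d \<ge> 2"
    and "prob_space Q" and "sets Q = sets (network_borel d)"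
    and "\<forall>p\<in>unlabeled_networks d. frechet_fun d Q p < \<infinity>"
    and "prob_space M"
    and "prob_space.indep_vars M (\<lambda>_. network_borel d) X {1..}"
    and "\<forall>i\<ge>1. distr M (network_borel d) (X i) = Q"
  shows "(frechet_mean_set d Q \<noteq> {} \<and> compactin (network_topology d) (frechet_mean_set d Q)) \<and>
         (\<forall>\<epsilon>>0. \<exists>N \<in> M \<rightarrow>\<^sub>M count_space UNIV. \<exists>\<Omega> \<in> null_sets M.
           (\<forall>\<omega>\<in>space M. 1 \<le> (N \<omega> :: nat)) \<and>
           (\<forall>\<omega>\<in>space M - \<Omega>. \<forall>n\<ge>N \<omega>.
              empirical_frechet_mean_set d n (\<lambda>i. X i \<omega>)
                \<subseteq> procrustes_nbhd d \<epsilon> (frechet_mean_set d Q))) \<and>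
         (\<forall>\<mu> m. frechet_mean_set d Q = {\<mu>} \<and>
           (\<forall>n\<ge>1. m n \<in> M \<rightarrow>\<^sub>M network_borel d \<and>
              (\<forall>\<omega>\<in>space M. m n \<omega> \<in> empirical_frechet_mean_set d n (\<lambda>i. X i \<omega>)))
           \<longrightarrow> (AE \<omega> in M. limitin (network_topology d) (\<lambda>n. m n \<omega>) \<mu> sequentially))"
proof -
  interpret Q: square_integrable_network_law Q d
    using assms(2-4) by (simp add: square_integrable_network_law_def square_integrable_network_law_axioms_def)
  note consistent = Q.empirical_mean_sets_eventually_in_nbhd[OF assms(5-7)]
  have converges: "AE \<omega> in M. limitin (network_topology d) (\<lambda>n. m n \<omega>) \<mu> sequentially"
    if single: "frechet_mean_set d Q = {\<mu>}"
      and m: "\<And>n \<omega>. n \<ge> 1 \<Longrightarrow> \<omega> \<in> space M \<Longrightarrow> m n \<omega> \<in> empirical_frechet_mean_set d n (\<lambda>i. X i \<omega>)"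
    for \<mu> m
  proof -
    have \<mu>U: "\<mu> \<in> unlabeled_networks d"
      using single Q.frechet_mean_set_iff by blast
    have near: "AE \<omega> in M. \<forall>\<^sub>F n in sequentially.
        m n \<omega> \<in> unlabeled_networks d \<and> procrustes_dist d (m n \<omega>) \<mu> < \<epsilon>" if \<epsilon>: "\<epsilon> > 0" for \<epsilon>
    proof -
      obtain N \<Omega> where "\<Omega> \<in> null_sets M"
        and sub: "\<forall>\<omega>\<in>space M - \<Omega>. \<forall>n\<ge>N \<omega>.
          empirical_frechet_mean_set d n (\<lambda>i. X i \<omega>) \<subseteq> procrustes_nbhd d \<epsilon> {\<mu>}"
        using consistent[OF \<epsilon>] unfolding single by blast
      have "\<forall>\<^sub>F n in sequentially. m n \<omega> \<in> unlabeled_networks d \<and> procrustes_dist d (m n \<omega>) \<mu> < \<epsilon>"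
        if \<omega>: "\<omega> \<in> space M - \<Omega>" for \<omega>
        \<comment> \<open>The choice \<open>m\<close> is constrained only from index 1 on.\<close>
        using eventually_ge_at_top[of "max 1 (N \<omega>)"]
      proof eventually_elim
        case (elim n)
        then have "m n \<omega> \<in> procrustes_nbhd d \<epsilon> {\<mu>}"
          using m[of n \<omega>] sub \<omega> by auto
        then show ?case by (simp add: procrustes_nbhd_def procrustes_setdist_def)
      qed
      then show ?thesis
        using \<open>\<Omega> \<in> null_sets M\<close> by (intro AE_I'[of \<Omega>]) auto
    qed
    \<comment> \<open>The null set in \<open>near\<close> depends on the radius; countably many
      radii 1 / (k + 1) suffice for convergence, and their null sets combine into one.\<close>
    have "AE \<omega> in M. \<forall>k::nat. \<forall>\<^sub>F n in sequentially.
        m n \<omega> \<in> unlabeled_networks d \<and> procrustes_dist d (m n \<omega>) \<mu> < 1 / real (Suc k)"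
      unfolding AE_all_countable by (intro allI near) simp
    then show ?thesis
    proof eventually_elim
      case (elim \<omega>)
      show ?case
        unfolding network_topology_def net.limitin_metric
      proof (intro conjI allI impI \<mu>U)
        fix \<epsilon> :: real assume "\<epsilon> > 0"
        then obtain k where "1 / real (Suc k) < \<epsilon>"
          using nat_approx_posE by blast
        with elim[rule_format, of k]
        show "\<forall>\<^sub>F n in sequentially. m n \<omega> \<in> unlabeled_networks d \<and> procrustes_dist d (m n \<omega>) \<mu> < \<epsilon>"
          by (auto elim: eventually_mono)
      qed
    qed
  qed
  show ?thesis
  proof (intro conjI allI impI Q.frechet_mean_set_nonempty Q.compactin_frechet_mean_set consistent)
    fix \<mu> m
    assume "frechet_mean_set d Q = {\<mu>} \<and>
      (\<forall>n\<ge>1. m n \<in> M \<rightarrow>\<^sub>M network_borel d \<and>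
        (\<forall>\<omega>\<in>space M. m n \<omega> \<in> empirical_frechet_mean_set d n (\<lambda>i. X i \<omega>)))"
    then show "AE \<omega> in M. limitin (network_topology d) (\<lambda>n. m n \<omega>) \<mu> sequentially"
      by (intro converges) auto
  qed
qed

end
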